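(* Let $n\ge 2$. For every $\alpha=(i,j)\in\mathbb{I}$, the dual basis matrix $v_\alpha$ has the form $$v_\alpha=-\frac{1}{2}\left(a b^\top+b a^\top\right),$$ where $a=e_i-\frac1n\mathbf{1}=J(:,i)$ and $b=e_j-\frac1n\mathbf{1}=J(:,j)$.
   Context: Let $\mathbb{I}=\{(i,j):1\le i<j\le n\}$, of size $L=n(n-1)/2$. Let $e_i\in\mathbb{R}^n$ be the $i$-th standard basis vector, $\mathbf{1}\in\mathbb{R}^n$ the all-ones vector, $J=I-\frac1n\mathbf{1}\mathbf{1}^\top$ the $n\times n$ centering matrix, and $J(:,i)$ its $i$-th column. Let $e_{i,j}\in\mathbb{R}^{n\times n}$ be the matrix whose only nonzero entry is a $1$ at position $(i,j)$. For $\alpha=(\alpha_1,\alpha_2)\in\mathbb{I}$ define $w_\alpha=e_{\alpha_1,\alpha_1}+e_{\alpha_2,\alpha_2}-e_{\alpha_1,\alpha_2}-e_{\alpha_2,\alpha_1}$; these form a basis of the space of symmetric $n\times n$ matrices $X$ with $X\mathbf{1}=0$. With the trace inner product $\langle X,Y\rangle=\operatorname{trace}(X^\top Y)$, let $H\in\mathbb{R}^{L\times L}$ have entries $H_{\alpha,\beta}=\langle w_\alpha,w_\beta\rangle$ (this matrix is symmetric positive definite). The dual basis matrices are $v_\alpha=\sum_{\beta\in\mathbb{I}}[H^{-1}]_{\alpha,\beta}\,w_\beta$; equivalently, $\{v_\alpha\}$ is the basis of the same space that satisfies $\langle v_\alpha,w_\beta\rangle=\delta_\alpha^\beta$ for all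 $\alpha,\beta\in\mathbb{I}$. *)

theory Defs
  imports "Jordan_Normal_Form.Gauss_Jordan_Elimination" "Jordan_Normal_Form.VS_Connect"
begin

text \<open>Matrices and vectors are indexed from 0, so the index set is
  \<open>{(i, j). 0 \<le> i < j < n}\<close>. The matrix \<open>H\<close>, whose rows and columns are indexed by these
  pairs, is represented as an \<open>L \<times> L\<close> matrix by listing the pairs lexicographically.\<close>

definition index_pairs :: "nat \<Rightarrow> (nat \<times> nat) set" where
  "index_pairs n = {(i, j). i < j \<and> j < n}"

definition pair_list :: "nat \<Rightarrow> (nat \<times> nat) list" where
  "pair_list n = [(i, j). i \<leftarrow> [0..<n], j \<leftarrow> [Suc i..<n]]"

lemma set_pair_list: "set (pair_list n) = index_pairs n"
  by (fastforce simp: pair_list_def index_pairs_def)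

lemma distinct_pair_list: "distinct (pair_list n)"
proof -
  have "distinct (concat (map (\<lambda>i. map (Pair i) [Suc i..<n]) xs))" if "distinct xs" for xs
    using that by (induction xs) (auto simp: distinct_map inj_on_def)
  then show ?thesis by (simp add: pair_list_def)
qed

lemma length_pair_list: "length (pair_list n) = n * (n - 1) div 2"
proof -
  have "length (pair_list n) = (\<Sum>i<n. n - Suc i)"
    by (simp add: pair_list_def length_concat comp_def interv_sum_list_conv_sum_set_nat
        lessThan_atLeast0)
  also have "\<dots> = (\<Sum>i<n. i)"
    by (rule sum.nat_diff_reindex)
  also have "\<dots> = n * (n - 1) div 2"
    by (simp add: lessThan_atLeast0 Sum_Ico_nat)
  finally show ?thesis .
qed

definition pair_index :: "nat \<Rightarrow> nat \<times> nat \<Rightarrow> nat" where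
  "pair_index n \<alpha> = find_index (pair_list n) \<alpha>"

definition ones_vec :: "nat \<Rightarrow> real vec" where
  "ones_vec n = vec n (\<lambda>_. 1)"

text \<open>\<open>outer_prod a b\<close> is \<open>a b\<^sup>T\<close>, with \<open>a\<close> and \<open>b\<close> read as one-column matrices.\<close>

definition outer_prod :: "real vec \<Rightarrow> real vec \<Rightarrow> real mat" where
  "outer_prod a b = mat_of_cols (dim_vec a) [a] * transpose_mat (mat_of_cols (dim_vec b) [b])"

definition centering_mat :: "nat \<Rightarrow> real mat" where
  "centering_mat n = 1\<^sub>m n - (1 / real n) \<cdot>\<^sub>m outer_prod (ones_vec n) (ones_vec n)"

definition unit_mat :: "nat \<Rightarrow> nat \<Rightarrow> nat \<Rightarrow> real mat" where
  "unit_mat n i j = mat n n (\<lambda>(r, c). if r = i \<and> c = j then 1 else 0)"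

definition trace_inner :: "real mat \<Rightarrow> real mat \<Rightarrow> real" where
  "trace_inner X Y = sum_list (diag_mat (transpose_mat X * Y))"

definition w_mat :: "nat \<Rightarrow> nat \<times> nat \<Rightarrow> real mat" where
  "w_mat n \<alpha> = unit_mat n (fst \<alpha>) (fst \<alpha>) + unit_mat n (snd \<alpha>) (snd \<alpha>)
    - unit_mat n (fst \<alpha>) (snd \<alpha>) - unit_mat n (snd \<alpha>) (fst \<alpha>)"

definition H_mat :: "nat \<Rightarrow> real mat" where
  "H_mat n = mat (length (pair_list n)) (length (pair_list n))
    (\<lambda>(k, l). trace_inner (w_mat n (pair_list n ! k)) (w_mat n (pair_list n ! l)))"

text \<open>\<open>mat_inverse\<close> returns an option; \<open>the\<close> is its value because \<open>H_mat n\<close> is positive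
  definite. The sum of matrices is taken in \<open>module_mat\<close>, as the type of matrices of all sizes
  is not an additive monoid.\<close>

definition v_mat :: "nat \<Rightarrow> nat \<times> nat \<Rightarrow> real mat" where
  "v_mat n \<alpha> = finsum (module_mat TYPE(real) n n)
    (\<lambda>\<beta>. (the (mat_inverse (H_mat n)) $$ (pair_index n \<alpha>, pair_index n \<beta>)) \<cdot>\<^sub>m w_mat n \<beta>)
    (index_pairs n)"

end

theory Submission
  imports Defs
begin

text \<open>
  Write \<open>u\<^sub>\<alpha>\<close> for the claimed matrix \<open>- (a b\<^sup>T + b a\<^sup>T) / 2\<close> (\<open>dual_mat\<close>).
  Two facts identify it with \<open>v\<^sub>\<alpha>\<close>.

  Biorthogonality: the functional \<open>\<langle>_, w\<^sub>(\<^sub>k\<^sub>,\<^sub>l\<^sub>)\<rangle>\<close> sends \<open>X\<close> to \<open>X\<^sub>k\<^sub>k + X\<^sub>l\<^sub>l - X\<^sub>k\<^sub>l - X\<^sub>l\<^sub>k\<close>, which on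
  \<open>u\<^sub>\<alpha>\<close> factors as \<open>- (a\<^sub>k - a\<^sub>l) (b\<^sub>k - b\<^sub>l)\<close>. The centering constant \<open>1 / n\<close> cancels in the
  differences, and for \<open>i < j\<close> and \<open>k < l\<close> what remains of the basis vectors is the Kronecker
  delta (\<open>trace_inner_dual_mat\<close>).

  Explicit coordinates: a symmetric matrix \<open>M\<close> with zero row sums equals
  \<open>\<Sum>\<^sub>k\<^sub><\<^sub>l (- M\<^sub>k\<^sub>l) w\<^sub>(\<^sub>k\<^sub>,\<^sub>l\<^sub>)\<close> (\<open>w_mat_expansion\<close>).

  Let \<open>C\<close> have as its row \<open>\<alpha>\<close> the coordinates of \<open>u\<^sub>\<alpha>\<close> (\<open>H_inv\<close>). Then
  \<open>(C H)\<^sub>\<alpha>\<^sub>\<beta> = \<langle>u\<^sub>\<alpha>, w\<^sub>\<beta>\<rangle> = \<delta>\<^sub>\<alpha>\<^sub>\<beta>\<close>, so \<open>C = H\<^sup>-\<^sup>1\<close>, and \<open>v\<^sub>\<alpha> = \<Sum>\<^sub>\<beta> C\<^sub>\<alpha>\<^sub>\<beta> w\<^sub>\<beta> = u\<^sub>\<alpha>\<close>. The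
  invertibility of \<open>H\<close> is part of the outcome, because a one-sided inverse of a square matrix over
  a field is two-sided.
\<close>

section \<open>Coordinates in the basis of the w matrices\<close>

lemma w_mat_carrier [simp]: "w_mat n \<alpha> \<in> carrier_mat n n"
  by (rule carrier_matI) (simp_all add: w_mat_def unit_mat_def)

lemma index_w_mat:
  assumes "r < n" "c < n"
  shows "w_mat n (k, l) $$ (r, c) =
    (if r = k \<and> c = k then 1 else 0) + (if r = l \<and> c = l then 1 else 0)
    - (if r = k \<and> c = l then 1 else 0) - (if r = l \<and> c = k then 1 else 0)"
  using assms by (simp add: w_mat_def unit_mat_def)

lemma trace_inner_eq_sum:
  assumes "X \<in> carrier_mat n n" "Y \<in> carrier_mat n n"
  shows "trace_inner X Y = (\<Sum>c<n. \<Sum>r<n. X $$ (r, c) * Y $$ (r, c))"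
  using assms
  by (auto simp: trace_inner_def diag_mat_def scalar_prod_def interv_sum_list_conv_sum_set_nat
      lessThan_atLeast0 intro!: sum.cong)

text \<open>The matrices \<open>e\<^sub>r\<^sub>c\<close> are orthonormal, so each of the four terms of \<open>w\<close> picks out one entry.\<close>

lemma trace_inner_w_mat:
  assumes "X \<in> carrier_mat n n" "k < n" "l < n"
  shows "trace_inner X (w_mat n (k, l)) =
    X $$ (k, k) + X $$ (l, l) - X $$ (k, l) - X $$ (l, k)"
proof -
  have entry: "(\<Sum>c<n. \<Sum>r<n. X $$ (r, c) * (if r = p \<and> c = q then 1 else 0)) = X $$ (p, q)"
    if "p < n" "q < n" for p q
  proof -
    have "(\<Sum>r<n. X $$ (r, c) * (if r = p \<and> c = q then 1 else 0)) =
      (if c = q then X $$ (p, c) else 0)" for c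
      using that(1) by (cases "c = q") (simp_all add: if_distrib cong: if_cong)
    then have "(\<Sum>c<n. \<Sum>r<n. X $$ (r, c) * (if r = p \<and> c = q then 1 else 0)) =
      (\<Sum>c<n. if c = q then X $$ (p, c) else 0)"
      by simp
    also have "\<dots> = X $$ (p, q)"
      using that by simp
    finally show ?thesis .
  qed
  have "trace_inner X (w_mat n (k, l)) = (\<Sum>c<n. \<Sum>r<n. X $$ (r, c) *
    ((if r = k \<and> c = k then 1 else 0) + (if r = l \<and> c = l then 1 else 0)
    - (if r = k \<and> c = l then 1 else 0) - (if r = l \<and> c = k then 1 else 0)))"
    unfolding trace_inner_eq_sum [OF assms(1) w_mat_carrier]
    by (intro sum.cong refl) (simp only: index_w_mat lessThan_iff)
  then show ?thesis
    unfolding distrib_left right_diff_distrib sum.distrib sum_subtractf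
    using assms(2,3) by (simp only: entry)
qed

lemma finite_index_pairs [simp]: "finite (index_pairs n)"
  unfolding set_pair_list [symmetric] by simp

lemma sum_square_eq_index_pairs:
  fixes f :: "nat \<Rightarrow> nat \<Rightarrow> real"
  assumes sym: "\<And>k l. k < n \<Longrightarrow> l < n \<Longrightarrow> f k l = f l k"
    and diag: "\<And>k. k < n \<Longrightarrow> f k k = 0"
  shows "(\<Sum>k<n. \<Sum>l<n. f k l) = 2 * (\<Sum>(k, l)\<in>index_pairs n. f k l)"
proof -
  let ?I = "index_pairs n" and ?D = "(\<lambda>k. (k, k)) ` {..<n}"
  let ?g = "\<lambda>(k, l). f k l"
  have split: "{..<n} \<times> {..<n} = (?I \<union> prod.swap ` ?I) \<union> ?D"
    by (force simp: index_pairs_def image_iff)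
  have disj: "?I \<inter> prod.swap ` ?I = {}" "(?I \<union> prod.swap ` ?I) \<inter> ?D = {}"
    by (auto simp: index_pairs_def)
  have swap: "sum ?g (prod.swap ` ?I) = sum ?g ?I"
    by (subst sum.reindex) (auto intro!: sum.cong simp: index_pairs_def sym)
  have zero: "sum ?g ?D = 0"
    by (intro sum.neutral) (auto simp: diag)
  have "(\<Sum>k<n. \<Sum>l<n. f k l) = sum ?g ({..<n} \<times> {..<n})"
    by (simp add: sum.cartesian_product)
  also have "\<dots> = sum ?g (?I \<union> prod.swap ` ?I) + sum ?g ?D"
    unfolding split by (rule sum.union_disjoint) (simp_all add: disj)
  also have "sum ?g (?I \<union> prod.swap ` ?I) = sum ?g ?I + sum ?g (prod.swap ` ?I)"
    by (rule sum.union_disjoint) (simp_all add: disj)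
  finally show ?thesis
    using swap zero by simp
qed

text \<open>Off the diagonal only one \<open>w\<close> contributes to a given entry; the diagonal entries are then
  forced by the zero row sums. Both cases are handled at once by summing over the full square
  of indices, where each pair occurs twice and \<open>w\<close> vanishes on the diagonal.\<close>

lemma w_mat_expansion:
  assumes sym: "\<And>k l. k < n \<Longrightarrow> l < n \<Longrightarrow> M $$ (k, l) = M $$ (l, k)"
    and rows: "\<And>k. k < n \<Longrightarrow> (\<Sum>l<n. M $$ (k, l)) = 0"
    and rc: "r < n" "c < n"
  shows "(\<Sum>\<gamma>\<in>index_pairs n. - M $$ \<gamma> * w_mat n \<gamma> $$ (r, c)) = M $$ (r, c)"
proof -
  let ?f = "\<lambda>k l. - M $$ (k, l) * w_mat n (k, l) $$ (r, c)"
  have cols: "(\<Sum>k<n. M $$ (k, l)) = 0" if "l < n" for l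
  proof -
    have "(\<Sum>k<n. M $$ (k, l)) = (\<Sum>k<n. M $$ (l, k))"
      by (intro sum.cong refl sym that) simp
    then show ?thesis
      using rows [OF that] by simp
  qed
  have "2 * (\<Sum>(k, l)\<in>index_pairs n. ?f k l) = (\<Sum>k<n. \<Sum>l<n. ?f k l)"
    by (rule sum_square_eq_index_pairs [symmetric]) (auto simp: index_w_mat rc sym)
  also have "\<dots> = (\<Sum>k<n. \<Sum>l<n. if k = r then (if r = c then - M $$ (k, l) else 0) else 0)
      + (\<Sum>k<n. \<Sum>l<n. if l = r then (if r = c then - M $$ (k, l) else 0) else 0)
      + (\<Sum>k<n. \<Sum>l<n. if l = c then (if k = r then M $$ (k, l) else 0) else 0)
      + (\<Sum>k<n. \<Sum>l<n. if l = r then (if k = c then M $$ (k, l) else 0) else 0)"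
    unfolding sum.distrib [symmetric]
    by (intro sum.cong refl) (auto simp: index_w_mat rc)
  also have "(\<Sum>k<n. \<Sum>l<n. if k = r then (if r = c then - M $$ (k, l) else 0) else 0) =
      (\<Sum>k<n. if k = r then (\<Sum>l<n. if r = c then - M $$ (k, l) else 0) else 0)"
    by (intro sum.cong refl) auto
  also have "\<dots> = 0"
    using rc rows [of r] by (cases "r = c") (simp_all add: sum_negf)
  also have "(\<Sum>k<n. \<Sum>l<n. if l = r then (if r = c then - M $$ (k, l) else 0) else 0) = 0"
    using rc cols [of r] by (cases "r = c") (simp_all add: sum_negf)
  finally show ?thesis
    using rc sym [of r c] by (simp add: case_prod_unfold)
qed

section \<open>The dual matrices\<close>

definition centered_unit :: "nat \<Rightarrow> nat \<Rightarrow> real vec" where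
  "centered_unit n i = unit_vec n i - (1 / real n) \<cdot>\<^sub>v ones_vec n"

definition dual_mat :: "nat \<Rightarrow> nat \<times> nat \<Rightarrow> real mat" where
  "dual_mat n = (\<lambda>(i, j). (- 1 / 2) \<cdot>\<^sub>m
    (outer_prod (centered_unit n i) (centered_unit n j)
     + outer_prod (centered_unit n j) (centered_unit n i)))"

lemma dim_centered_unit [simp]: "dim_vec (centered_unit n i) = n"
  by (simp add: centered_unit_def ones_vec_def)

lemma index_centered_unit:
  "k < n \<Longrightarrow> centered_unit n i $ k = (if k = i then 1 else 0) - 1 / real n"
  by (simp add: centered_unit_def ones_vec_def unit_vec_def)

lemma sum_centered_unit:
  assumes "i < n"
  shows "(\<Sum>k<n. centered_unit n i $ k) = 0"
proof -
  have "(\<Sum>k<n. centered_unit n i $ k) = (\<Sum>k<n. (if k = i then 1 else 0) - 1 / real n)"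
    by (intro sum.cong refl) (simp only: index_centered_unit lessThan_iff)
  also have "\<dots> = 1 - (\<Sum>k<n. 1 / real n)"
    unfolding sum_subtractf using assms by simp
  also have "\<dots> = 0"
    using assms by simp
  finally show ?thesis .
qed

lemma dim_outer_prod [simp]:
  "dim_row (outer_prod a b) = dim_vec a" "dim_col (outer_prod a b) = dim_vec b"
  by (simp_all add: outer_prod_def)

lemma outer_prod_carrier [simp]: "outer_prod a b \<in> carrier_mat (dim_vec a) (dim_vec b)"
  by (rule carrier_matI) simp_all

lemma index_outer_prod:
  assumes "r < dim_vec a" "c < dim_vec b"
  shows "outer_prod a b $$ (r, c) = a $ r * b $ c"
  using assms by (simp add: outer_prod_def scalar_prod_def mat_of_cols_def)

lemma col_centering_mat: "i < n \<Longrightarrow> col (centering_mat n) i = centered_unit n i"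
  by (rule eq_vecI)
    (auto simp: centering_mat_def index_centered_unit index_outer_prod ones_vec_def)

lemma dual_mat_carrier [simp]: "dual_mat n \<alpha> \<in> carrier_mat n n"
  by (rule carrier_matI) (simp_all add: dual_mat_def split: prod.split)

lemma index_dual_mat:
  assumes "k < n" "l < n"
  shows "dual_mat n (i, j) $$ (k, l) =
    - (centered_unit n i $ k * centered_unit n j $ l
       + centered_unit n j $ k * centered_unit n i $ l) / 2"
  using assms by (simp add: dual_mat_def index_outer_prod add_divide_distrib)

text \<open>The rows of \<open>u\<^sub>\<alpha>\<close> sum to zero because the entries of \<open>a\<close> and of \<open>b\<close> do.\<close>

lemma dual_mat_expansion:
  assumes "\<alpha> \<in> index_pairs n" "r < n" "c < n"
  shows "(\<Sum>\<gamma>\<in>index_pairs n. - dual_mat n \<alpha> $$ \<gamma> * w_mat n \<gamma> $$ (r, c)) = dual_mat n \<alpha> $$ (r, c)"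
proof (rule w_mat_expansion)
  obtain i j where \<alpha>: "\<alpha> = (i, j)" "i < n" "j < n"
    using assms(1) by (auto simp: index_pairs_def)
  show "dual_mat n \<alpha> $$ (k, l) = dual_mat n \<alpha> $$ (l, k)" if "k < n" "l < n" for k l
    using that by (simp add: \<alpha>(1) index_dual_mat algebra_simps)
  show "(\<Sum>l<n. dual_mat n \<alpha> $$ (k, l)) = 0" if "k < n" for k
  proof -
    let ?a = "centered_unit n i" and ?b = "centered_unit n j"
    have "(\<Sum>l<n. dual_mat n \<alpha> $$ (k, l)) =
      (\<Sum>l<n. (- ?a $ k / 2) * ?b $ l + (- ?b $ k / 2) * ?a $ l)"
      using that by (intro sum.cong refl) (simp add: \<alpha>(1) index_dual_mat field_simps)
    also have "\<dots> = (- ?a $ k / 2) * (\<Sum>l<n. ?b $ l) + (- ?b $ k / 2) * (\<Sum>l<n. ?a $ l)"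
      unfolding sum.distrib sum_distrib_left ..
    also have "\<dots> = 0"
      using \<alpha>(2,3) by (simp add: sum_centered_unit)
    finally show ?thesis .
  qed
qed (use assms in simp_all)

lemma trace_inner_dual_mat:
  assumes "\<alpha> \<in> index_pairs n" "\<beta> \<in> index_pairs n"
  shows "trace_inner (dual_mat n \<alpha>) (w_mat n \<beta>) = (if \<alpha> = \<beta> then 1 else 0)"
proof -
  obtain i j k l where \<alpha>\<beta>: "\<alpha> = (i, j)" "\<beta> = (k, l)"
    and ij: "i < j" and kl: "k < l" "k < n" "l < n"
    using assms by (auto simp: index_pairs_def)
  let ?a = "centered_unit n i" and ?b = "centered_unit n j"
  have "trace_inner (dual_mat n \<alpha>) (w_mat n \<beta>) = - ((?a $ k - ?a $ l) * (?b $ k - ?b $ l))"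
    using kl by (simp add: \<alpha>\<beta> trace_inner_w_mat index_dual_mat field_simps)
  also have "\<dots> = (if \<alpha> = \<beta> then 1 else 0)"
    using ij kl by (auto simp: \<alpha>\<beta> index_centered_unit)
  finally show ?thesis .
qed

section \<open>The inverse of the Gram matrix\<close>

abbreviation num_pairs :: "nat \<Rightarrow> nat" where
  "num_pairs n \<equiv> length (pair_list n)"

definition H_inv :: "nat \<Rightarrow> real mat" where
  "H_inv n = mat (num_pairs n) (num_pairs n)
    (\<lambda>(p, q). - dual_mat n (pair_list n ! p) $$ (pair_list n ! q))"

lemma nth_pair_list: "p < num_pairs n \<Longrightarrow> pair_list n ! p \<in> index_pairs n"
  using nth_mem set_pair_list by metis

lemma sum_pair_list:
  "(\<Sum>p<num_pairs n. f (pair_list n ! p)) = (\<Sum>\<gamma>\<in>index_pairs n. f \<gamma>)"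
  by (rule sum.reindex_bij_betw, rule bij_betw_nth) (simp_all add: distinct_pair_list set_pair_list)

text \<open>Pairing with \<open>w\<^sub>\<beta>\<close> is a linear combination of four entries, so it can be exchanged with the
  expansion of \<open>u\<^sub>\<alpha>\<close>, which turns the product of coordinates and Gram matrix into
  \<open>\<langle>u\<^sub>\<alpha>, w\<^sub>\<beta>\<rangle>\<close>.\<close>

lemma dual_mat_gram:
  assumes "\<alpha> \<in> index_pairs n" "\<beta> \<in> index_pairs n"
  shows "(\<Sum>\<gamma>\<in>index_pairs n. - dual_mat n \<alpha> $$ \<gamma> * trace_inner (w_mat n \<gamma>) (w_mat n \<beta>)) =
    (if \<alpha> = \<beta> then 1 else 0)"
proof -
  obtain k l where \<beta>: "\<beta> = (k, l)" "k < n" "l < n"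
    using assms(2) by (auto simp: index_pairs_def)
  have "(\<Sum>\<gamma>\<in>index_pairs n. - dual_mat n \<alpha> $$ \<gamma> * trace_inner (w_mat n \<gamma>) (w_mat n \<beta>)) =
    trace_inner (dual_mat n \<alpha>) (w_mat n \<beta>)"
    unfolding \<beta>(1) trace_inner_w_mat [OF w_mat_carrier \<beta>(2,3)]
      trace_inner_w_mat [OF dual_mat_carrier \<beta>(2,3)]
      distrib_left right_diff_distrib sum.distrib sum_subtractf
    using assms(1) \<beta>(2,3) by (simp only: dual_mat_expansion)
  then show ?thesis
    using assms by (simp add: trace_inner_dual_mat)
qed

lemma H_inv_mult_H_mat: "H_inv n * H_mat n = 1\<^sub>m (num_pairs n)"
proof (rule eq_matI)
  fix p q assume "p < dim_row (1\<^sub>m (num_pairs n))" "q < dim_col (1\<^sub>m (num_pairs n))"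
  then have pq: "p < num_pairs n" "q < num_pairs n"
    by simp_all
  let ?\<alpha> = "pair_list n ! p" and ?\<beta> = "pair_list n ! q"
  have "(H_inv n * H_mat n) $$ (p, q) =
    (\<Sum>m<num_pairs n. - dual_mat n ?\<alpha> $$ (pair_list n ! m) *
      trace_inner (w_mat n (pair_list n ! m)) (w_mat n ?\<beta>))"
    using pq by (simp add: H_inv_def H_mat_def scalar_prod_def lessThan_atLeast0)
  also have "\<dots> = (if ?\<alpha> = ?\<beta> then 1 else 0)"
    unfolding sum_pair_list
      [of "\<lambda>\<gamma>. - dual_mat n ?\<alpha> $$ \<gamma> * trace_inner (w_mat n \<gamma>) (w_mat n ?\<beta>)"]
    by (intro dual_mat_gram nth_pair_list pq)
  also have "\<dots> = 1\<^sub>m (num_pairs n) $$ (p, q)"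
    using pq by (simp add: nth_eq_iff_index_eq distinct_pair_list)
  finally show "(H_inv n * H_mat n) $$ (p, q) = 1\<^sub>m (num_pairs n) $$ (p, q)" .
qed (simp_all add: H_inv_def H_mat_def)

lemma mat_inverse_eqI:
  fixes A B :: "'a :: field mat"
  assumes A: "A \<in> carrier_mat n n" and B: "B \<in> carrier_mat n n" and BA: "B * A = 1\<^sub>m n"
  shows "mat_inverse A = Some B"
proof (cases "mat_inverse A")
  case None
  have "A * B = 1\<^sub>m n"
    using mat_mult_left_right_inverse [OF B A BA] .
  then have "A \<in> Units (ring_mat TYPE('a) n ())"
    using A B BA by (auto simp: Units_def ring_mat_def)
  then show ?thesis
    using mat_inverse(1) [OF A None, of "()"] by contradiction
next
  case (Some B')
  then have B': "A * B' = 1\<^sub>m n" "B' \<in> carrier_mat n n"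
    using mat_inverse(2) [OF A] by blast+
  have "B = B * (A * B')"
    using B B' by simp
  also have "\<dots> = (B * A) * B'"
    using A B B' by (simp add: assoc_mult_mat)
  finally show ?thesis
    using Some B' BA by simp
qed

lemma mat_inverse_H_mat: "mat_inverse (H_mat n) = Some (H_inv n)"
  by (rule mat_inverse_eqI [OF _ _ H_inv_mult_H_mat]) (simp_all add: H_inv_def H_mat_def)

section \<open>The dual basis\<close>

lemma finsum_mat:
  fixes F :: "'b \<Rightarrow> 'a :: comm_ring_1 mat"
  assumes "finite S" "\<And>s. s \<in> S \<Longrightarrow> F s \<in> carrier_mat nr nc"
  shows "finsum (module_mat TYPE('a) nr nc) F S = mat nr nc (\<lambda>rc. \<Sum>s\<in>S. F s $$ rc)"
  using assms
proof (induction S rule: finite_induct)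
  interpret abelian_group "module_mat TYPE('a) nr nc"
    by (rule abelian_group_mat)
  {
    case empty
    show ?case
      by (auto simp: module_mat_simps)
  next
    case (insert s S)
    then show ?case
      by (subst finsum_insert) (auto simp: module_mat_simps)
  }
qed

lemma v_mat_eq_dual_mat:
  assumes \<alpha>: "\<alpha> \<in> index_pairs n"
  shows "v_mat n \<alpha> = dual_mat n \<alpha>"
proof -
  have coord: "H_inv n $$ (pair_index n \<alpha>, pair_index n \<beta>) = - dual_mat n \<alpha> $$ \<beta>"
    if "\<beta> \<in> index_pairs n" for \<beta>
    using \<alpha> that
    by (simp add: H_inv_def pair_index_def find_index_in_set find_index_leq_length
        flip: set_pair_list)
  have "v_mat n \<alpha> = mat n n (\<lambda>rc. \<Sum>\<beta>\<in>index_pairs n.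
    (H_inv n $$ (pair_index n \<alpha>, pair_index n \<beta>) \<cdot>\<^sub>m w_mat n \<beta>) $$ rc)"
    unfolding v_mat_def mat_inverse_H_mat option.sel by (rule finsum_mat) simp_all
  also have "\<dots> = dual_mat n \<alpha>"
  proof (rule eq_matI)
    fix r c assume "r < dim_row (dual_mat n \<alpha>)" "c < dim_col (dual_mat n \<alpha>)"
    then have rc: "r < n" "c < n"
      by (simp_all add: carrier_matD [OF dual_mat_carrier])
    have "(\<Sum>\<beta>\<in>index_pairs n.
        (H_inv n $$ (pair_index n \<alpha>, pair_index n \<beta>) \<cdot>\<^sub>m w_mat n \<beta>) $$ (r, c)) =
      (\<Sum>\<beta>\<in>index_pairs n. - dual_mat n \<alpha> $$ \<beta> * w_mat n \<beta> $$ (r, c))"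
      using rc by (intro sum.cong refl) (simp add: coord carrier_matD [OF w_mat_carrier])
    then show "mat n n (\<lambda>rc. \<Sum>\<beta>\<in>index_pairs n.
        (H_inv n $$ (pair_index n \<alpha>, pair_index n \<beta>) \<cdot>\<^sub>m w_mat n \<beta>) $$ rc) $$ (r, c) =
      dual_mat n \<alpha> $$ (r, c)"
      using rc dual_mat_expansion [OF \<alpha> rc] by simp
  qed (simp_all add: carrier_matD [OF dual_mat_carrier])
  finally show ?thesis .
qed

theorem claim3:
  fixes n i j :: nat
  assumes "n \<ge> 2" and "(i, j) \<in> index_pairs n"
  shows "let a = unit_vec n i - (1 / real n) \<cdot>\<^sub>v ones_vec n;
             b = unit_vec n j - (1 / real n) \<cdot>\<^sub>v ones_vec n
         in a = col (centering_mat n) i \<and> b = col (centering_mat n) j \<and>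
            v_mat n (i, j) = (- 1 / 2) \<cdot>\<^sub>m (outer_prod a b + outer_prod b a)"
proof -
  have "i < n" "j < n"
    using assms(2) by (auto simp: index_pairs_def)
  then show ?thesis
    using v_mat_eq_dual_mat [OF assms(2)]
    unfolding Let_def dual_mat_def centered_unit_def [symmetric]
    by (simp add: col_centering_mat)
qed

end
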